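(* Let $X$ and $A$ be terms and $\Gamma$ a sequent. There exists a proof of $\Gamma \vdash A$ in $\mathbb{T}[X]$ if and only if there exists a proof of $\Gamma, X^m \vdash A$ in $\mathbb{T}$ for some integer $m\ge 0$, where $X^m$ denotes $m$ copies of $X$ in the antecedent.
   Context: Fix a countable set $\Phi$ of atomic propositions. Terms are generated from the elements of $\Phi$ and a constant $\mathbb{1}$ using a binary connective $\otimes$ (with parentheses). A sequent is a (possibly empty, not necessarily finite) multiset of terms; a comma denotes multiset union. An inference is an expression $\Gamma \vdash A$ with $\Gamma$ a sequent and $A$ a term. The system $\mathbb{T}$ has the following deduction rules. (Id) $P \vdash P$ for every atomic proposition $P\in\Phi$. (Cut) From $\Gamma \vdash B$ and $\Delta, B \vdash A$ deduce $\Delta,\Gamma \vdash A$, for any term $B$. (L-$\mathbb{1}$) From $\Gamma \vdash A$ deduce $\Gamma, \mathbb{1} \vdash A$. (R-$\mathbb{1}$) $\vdash \mathbb{1}$. (L-$\otimes$) From $A, B, \Gamma \vdash C$ deduce $A\otimes B, \Gamma \vdash C$. (R-$\otimes$) From $\Gamma \vdash A$ and $\Delta \vdash B$ deduce $\Gamma,\Delta \vdash A\otimes B$. (Exchange) Antecedent terms may be reordered arbitrarily (automatic when antecedents are multisets). A proof of an inference is a finite tree of rule applications with that inference as conclusion. For a term $X$, the system $\mathbb{T}[X]$ has all the rules of $\mathbb{T}$ together with the rule (R-$X$): $\vdash X$ (no assumptions). *)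

theory Defs
  imports "HOL-Library.Extended_Nat" "HOL-Library.Function_Algebras" "HOL-Library.Countable_Set"
begin

datatype (atoms: 'p) tm = Atom 'p | One ("\<one>") | Tensor "'p tm" "'p tm" (infixr "\<otimes>" 70)

definition terms :: "'p set \<Rightarrow> 'p tm set" where
  "terms \<Phi> = {t. atoms t \<subseteq> \<Phi>}"

text \<open>
  Sequents need not be finite, so the type \<open>multiset\<close> does not apply: a sequent is a multiplicity
  function with values in \<open>enat\<close>, allowing both infinite support and infinite multiplicities.
  Multiset union (the comma) is the pointwise sum \<open>+\<close>, and the empty sequent is \<open>0\<close>.
\<close>

type_synonym 'p sequent = "'p tm \<Rightarrow> enat"

definition sequents :: "'p set \<Rightarrow> 'p sequent set" where
  "sequents \<Phi> = {\<Gamma>. \<forall>t. \<Gamma> t \<noteq> 0 \<longrightarrow> t \<in> terms \<Phi>}"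

definition copies :: "nat \<Rightarrow> 'p tm \<Rightarrow> 'p sequent" where
  "copies m t = (\<lambda>s. if s = t then enat m else 0)"

abbreviation single :: "'p tm \<Rightarrow> 'p sequent" where
  "single t \<equiv> copies 1 t"

text \<open>
  Derivability over the atoms \<open>\<Phi>\<close> in the system \<open>T\<close> extended by the rule that \<open>\<turnstile> Y\<close> for
  every \<open>Y \<in> S\<close>. All rules have finitely many premises, so the derivable inferences are exactly
  the conclusions of finite proof trees. Restricting the identity rule to \<open>\<Phi>\<close> confines every
  derivation to terms over \<open>\<Phi>\<close>, see \<open>derivable_over\<close> below. Exchange is implicit.
\<close>

inductive derivable :: "'p set \<Rightarrow> 'p tm set \<Rightarrow> 'p sequent \<Rightarrow> 'p tm \<Rightarrow> bool"
  for \<Phi> :: "'p set" and S :: "'p tm set" where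
  Id: "P \<in> \<Phi> \<Longrightarrow> derivable \<Phi> S (single (Atom P)) (Atom P)"
| Cut: "derivable \<Phi> S \<Gamma> B \<Longrightarrow> derivable \<Phi> S (\<Delta> + single B) A \<Longrightarrow> derivable \<Phi> S (\<Delta> + \<Gamma>) A"
| L_One: "derivable \<Phi> S \<Gamma> A \<Longrightarrow> derivable \<Phi> S (\<Gamma> + single \<one>) A"
| R_One: "derivable \<Phi> S 0 \<one>"
| L_Tensor: "derivable \<Phi> S (single A + single B + \<Gamma>) C \<Longrightarrow>
    derivable \<Phi> S (single (A \<otimes> B) + \<Gamma>) C"
| R_Tensor: "derivable \<Phi> S \<Gamma> A \<Longrightarrow> derivable \<Phi> S \<Delta> B \<Longrightarrow> derivable \<Phi> S (\<Gamma> + \<Delta>) (A \<otimes> B)"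
| R_Axiom: "Y \<in> S \<Longrightarrow> derivable \<Phi> S 0 Y"

definition T_provable :: "'p set \<Rightarrow> 'p sequent \<Rightarrow> 'p tm \<Rightarrow> bool" where
  "T_provable \<Phi> = derivable \<Phi> {}"

definition T_ext_provable :: "'p set \<Rightarrow> 'p tm \<Rightarrow> 'p sequent \<Rightarrow> 'p tm \<Rightarrow> bool" where
  "T_ext_provable \<Phi> X = derivable \<Phi> {X}"

lemma zero_in_sequents [simp]: "0 \<in> sequents \<Phi>"
  by (simp add: sequents_def)

lemma plus_in_sequents [simp]:
  "\<Gamma> + \<Delta> \<in> sequents \<Phi> \<longleftrightarrow> \<Gamma> \<in> sequents \<Phi> \<and> \<Delta> \<in> sequents \<Phi>"
  by (auto simp: sequents_def)

lemma copies_in_sequents [simp]: "copies m t \<in> sequents \<Phi> \<longleftrightarrow> m = 0 \<or> t \<in> terms \<Phi>"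
  by (auto simp: sequents_def copies_def zero_enat_def)

lemma derivable_over:
  assumes "derivable \<Phi> S \<Gamma> A" "S \<subseteq> terms \<Phi>"
  shows "\<Gamma> \<in> sequents \<Phi> \<and> A \<in> terms \<Phi>"
  using assms by induction (auto simp: terms_def)

end

theory Submission
  imports Defs
begin

text \<open>
  Replacing each use of (R-\<open>X\<close>) by the identity \<open>X \<turnstile> X\<close> leaves one copy of \<open>X\<close> in the antecedent
  per use; conversely, each such copy is removed by a cut against \<open>\<turnstile> X\<close>.
\<close>

(* single t abbreviates copies 1 t, which One_nat_def would rewrite to copies (Suc 0) t. *)
declare One_nat_def [simp del]

lemma copies_0 [simp]: "copies 0 t = 0"
  by (simp add: copies_def zero_enat_def fun_eq_iff)

lemma copies_add: "copies (m + n) t = copies m t + copies n t"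
  by (simp add: copies_def fun_eq_iff flip: plus_enat_simps(1))

text \<open>The rule \<open>Id\<close> covers atoms only; for compound terms the right rule of the
  outermost connective followed by its left rule rebuilds the identity. This lets X be any term over
  \<Phi> in the case \<open>R_Axiom\<close> below.\<close>

lemma derivable_identity:
  assumes "t \<in> terms \<Phi>"
  shows "derivable \<Phi> S (single t) t"
  using assms
proof (induction t)
  case (Atom P)
  then show ?case
    by (auto simp: terms_def intro: derivable.Id)
next
  case One
  show ?case
    using derivable.L_One[OF derivable.R_One] by (metis add_0)
next
  case (Tensor A B)
  then have "derivable \<Phi> S (single A + single B) (A \<otimes> B)"
    by (auto simp: terms_def intro: derivable.R_Tensor)
  then show ?case
    using derivable.L_Tensor[of \<Phi> S A B 0] by simp
qed

lemma derivable_mono: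
  assumes "derivable \<Phi> S \<Gamma> A" and "S \<subseteq> S'"
  shows "derivable \<Phi> S' \<Gamma> A"
  using assms by induction (auto intro: derivable.intros)

text \<open>The antecedent of \<open>R_Axiom\<close> is empty, so a cut against it deletes one X and
  adds nothing. As m is finite, finitely many cuts suffice, whatever the multiplicity of X in
  \<Gamma>.\<close>

lemma derivable_cut_axiom_copies:
  assumes "derivable \<Phi> S (\<Gamma> + copies m X) A" and "X \<in> S"
  shows "derivable \<Phi> S \<Gamma> A"
  using assms(1)
proof (induction m)
  case 0
  then show ?case by simp
next
  case (Suc m)
  then have "derivable \<Phi> S ((\<Gamma> + copies m X) + single X) A"
    by (simp only: Suc_eq_plus1 copies_add add.assoc)
  from derivable.Cut[OF derivable.R_Axiom[OF assms(2)] this] show ?case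
    by (intro Suc.IH) (simp only: add_0_right)
qed

text \<open>The extra copies of X are passive context in every rule, and rules with two premises add
  their counts. Copies are only ever added, never subtracted, so infinite multiplicities in \<Gamma>
  cause no trouble.\<close>

lemma derivable_axiom_as_copies:
  assumes "derivable \<Phi> {X} \<Gamma> A" and "X \<in> terms \<Phi>"
  shows "\<exists>m. derivable \<Phi> {} (\<Gamma> + copies m X) A"
  using assms(1)
proof induction
  case (Id P)
  then have "derivable \<Phi> {} (single (Atom P) + copies 0 X) (Atom P)"
    by (simp add: derivable.Id)
  then show ?case ..
next
  case (Cut \<Gamma> B \<Delta> A)
  then obtain m n where "derivable \<Phi> {} (\<Gamma> + copies m X) B"
    and "derivable \<Phi> {} ((\<Delta> + single B) + copies n X) A"
    by blast
  \<comment> \<open>The copies from the right premise join the side context, leaving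
    \<open>single B\<close> as the cut term; this is sound even if B = X.\<close>
  moreover have "(\<Delta> + single B) + copies n X = (\<Delta> + copies n X) + single B"
    by (simp only: ac_simps)
  ultimately have "derivable \<Phi> {} ((\<Delta> + copies n X) + (\<Gamma> + copies m X)) A"
    using derivable.Cut by metis
  then have "derivable \<Phi> {} (\<Delta> + \<Gamma> + copies (m + n) X) A"
    by (simp only: copies_add ac_simps)
  then show ?case ..
next
  case (L_One \<Gamma> A)
  then obtain m where "derivable \<Phi> {} (\<Gamma> + copies m X) A" by blast
  from derivable.L_One[OF this] have "derivable \<Phi> {} (\<Gamma> + single \<one> + copies m X) A"
    by (simp only: ac_simps)
  then show ?case ..
next
  case R_One
  have "derivable \<Phi> {} (0 + copies 0 X) \<one>"
    by (simp add: derivable.R_One)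
  then show ?case ..
next
  case (L_Tensor A B \<Gamma> C)
  then obtain m where "derivable \<Phi> {} (single A + single B + \<Gamma> + copies m X) C"
    by blast
  then have "derivable \<Phi> {} (single A + single B + (\<Gamma> + copies m X)) C"
    by (simp only: add.assoc)
  from derivable.L_Tensor[OF this]
  have "derivable \<Phi> {} (single (A \<otimes> B) + \<Gamma> + copies m X) C"
    by (simp only: add.assoc)
  then show ?case ..
next
  case (R_Tensor \<Gamma> A \<Delta> B)
  then obtain m n where "derivable \<Phi> {} (\<Gamma> + copies m X) A"
    and "derivable \<Phi> {} (\<Delta> + copies n X) B"
    by blast
  from derivable.R_Tensor[OF this]
  have "derivable \<Phi> {} (\<Gamma> + \<Delta> + copies (m + n) X) (A \<otimes> B)"
    by (simp only: copies_add ac_simps)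
  then show ?case ..
next
  case (R_Axiom Y)
  \<comment> \<open>Here Y = X. This is the only case that creates a copy of X.\<close>
  then have "derivable \<Phi> {} (0 + copies 1 X) Y"
    using derivable_identity[OF assms(2)] by simp
  then show ?case ..
qed

theorem theorem11:
  fixes \<Phi> :: "'p set" and X A :: "'p tm" and \<Gamma> :: "'p sequent"
  assumes "countable \<Phi>"
    and "X \<in> terms \<Phi>" and "A \<in> terms \<Phi>" and "\<Gamma> \<in> sequents \<Phi>"
  shows "T_ext_provable \<Phi> X \<Gamma> A \<longleftrightarrow> (\<exists>m::nat. T_provable \<Phi> (\<Gamma> + copies m X) A)"
proof
  assume "T_ext_provable \<Phi> X \<Gamma> A"
  then show "\<exists>m. T_provable \<Phi> (\<Gamma> + copies m X) A"
    unfolding T_ext_provable_def T_provable_def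
    by (rule derivable_axiom_as_copies[OF _ assms(2)])
next
  assume "\<exists>m. T_provable \<Phi> (\<Gamma> + copies m X) A"
  then obtain m where "derivable \<Phi> {} (\<Gamma> + copies m X) A"
    unfolding T_provable_def ..
  \<comment> \<open>The cuts need the axiom for X, so the derivation first moves to the larger
    system.\<close>
  then have "derivable \<Phi> {X} (\<Gamma> + copies m X) A"
    by (rule derivable_mono) simp
  then show "T_ext_provable \<Phi> X \<Gamma> A"
    unfolding T_ext_provable_def by (rule derivable_cut_axiom_copies) simp
qed

end
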